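(* The mother group $G_3$ contains a subgroup $T$ such that, with respect to any proper length metric on $T$, one has $T\in\mathcal{D}_\omega$ and $\operatorname{asdim}T=\infty$, where $\omega$ is the first infinite ordinal.
   Context: Rooted trees. Let $X=\{1,2,3\}$, and let $X^*$ be the set of finite words over $X$ (including the empty word $\emptyset$), viewed as the vertex set of the 3-regular rooted tree $T_3$ with root $\emptyset$, where $w$ and $wx$ are joined by an edge for $w\in X^*$, $x\in X$. $\mathrm{Aut}(T_3)=\mathrm{Aut}(X^* )$ is the group of bijections of $X^*$ preserving the root and adjacency. For $g\in\mathrm{Aut}(X^* )$ and $v\in X^*$, the restriction $g|_v$ is defined by $g(vw)=g(v)\,g|_v(w)$ for all $w\in X^*$. One writes $g=(g|_1,g|_2,g|_3)\sigma$, where $\sigma\in S_3$ is the action of $g$ on the first level $X$. Multiplication is $(g_1,g_2,g_3)\sigma\cdot(h_1,h_2,h_3)\tau=(g_1h_{\sigma(1)},g_2h_{\sigma(2)},g_3h_{\sigma(3)})\sigma\tau$; products of permutations and of automorphisms are read from left to right ($gh$ means first $g$, then $h$). Mother group $G_3$. Each $a\in S_3$ is regarded as the automorphism $a=(1,1,1)a$. Let $B_3=S_3\wr 2=S_3^2\rtimes S_2$; each $b=(b_1,b_2)\sigma\in B_3$ (with $b_1,b_2\in S_3$, $\sigma\in S_2$ acting on $\{1,2\}$ and extended to fix $3$) is regarded as the automorphism of $T_3$ defined recursively by $b=(b_1,b_2,b)\sigma$. $G_3$ is the subgroup of $\mathrm{Aut}(T_3)$ generated by the images of $S_3$ and $B_3$.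 Metric. A length function $l$ on a group is proper if every ball $\{g:l(g)\le R\}$ is finite; it induces the (proper length) metric $d(g,h)=l(gh^{-1})$. Countable groups are considered as metric spaces via any proper length metric (any two such metrics on a group are coarsely equivalent). A family of subsets of a metric space is $r$-disjoint if any two distinct members $U,U'$ satisfy $\inf\{d(x,x'):x\in U,x'\in U'\}>r$. Asymptotic dimension. A metric space $Y$ satisfies $\operatorname{asdim}Y\le n$ if for every $r>0$ one can write $Y=\bigcup_{i=0}^n Y_i$ where each $Y_i$ is the union of an $r$-disjoint family $\{Y_{ij}\}_j$ with $\sup_{i,j}\operatorname{diam}Y_{ij}<\infty$. $\operatorname{asdim}Y=\infty$ means that $\operatorname{asdim}Y\le n$ holds for no $n$. Decomposition complexity. A metric family is a collection of metric spaces. A metric family $\mathcal{X}$ is $r$-decomposable over a metric family $\mathcal{Y}$, written $\mathcal{X}\stackrel{r}{\to}\mathcal{Y}$, if every $Z\in\mathcal{X}$ can be written as $Z=Z_0\cup Z_1$ where each $Z_i$ is the union of an $r$-disjoint family $\{Z_{ij}\}_j$ with all $Z_{ij}\in\mathcal{Y}$. $\mathcal{D}_0$ is the collection of bounded families (families whose members have uniformly bounded diameter), and for an ordinal $\alpha>0$, $\mathcal{D}_\alpha=\{\mathcal{X}:\forall r>0\ \exists\beta<\alpha\ \exists\mathcal{Y}\in\mathcal{D}_\beta\text{ with }\mathcal{X}\stackrel{r}{\to}\mathcal{Y}\}$. For a single metric space $Y$, $Y\in\mathcal{D}_\alpha$ means $\{Y\}\in\mathcal{D}_\alpha$. *)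

theory Defs
  imports
    "HOL-Analysis.Analysis"
    "HOL-Algebra.Elementary_Groups"
    "HOL-Library.Extended_Nat"
begin

section \<open>The rooted ternary tree and its automorphisms\<close>

datatype letter = X1 | X2 | X3

type_synonym word = "letter list"

definition tree_adj :: "word \<Rightarrow> word \<Rightarrow> bool" where
  "tree_adj u v \<longleftrightarrow> (\<exists>x. v = u @ [x] \<or> u = v @ [x])"

text \<open>Products are read from left to right, hence the order in the composition.\<close>

definition tree_aut :: "(word \<Rightarrow> word) monoid" where
  "tree_aut =
    \<lparr>carrier = {g. bij g \<and> g [] = [] \<and> (\<forall>u v. tree_adj (g u) (g v) \<longleftrightarrow> tree_adj u v)},
     mult = (\<lambda>g h. h \<circ> g),
     one = id\<rparr>"

text \<open>A permutation \<open>a\<close> of the first level, regarded as \<open>(1,1,1)a\<close>.\<close>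

fun rooted :: "(letter \<Rightarrow> letter) \<Rightarrow> word \<Rightarrow> word" where
  "rooted a [] = []"
| "rooted a (x # w) = a x # w"

text \<open>The automorphism \<open>b = (b\<^sub>1,b\<^sub>2,b)\<sigma>\<close>, that is
  \<open>b(xw) = \<sigma>(x) b|\<^sub>x(w)\<close> for a letter \<open>x\<close> and a word \<open>w\<close>.\<close>

fun directed ::
    "(letter \<Rightarrow> letter) \<Rightarrow> (letter \<Rightarrow> letter) \<Rightarrow> (letter \<Rightarrow> letter) \<Rightarrow> word \<Rightarrow> word" where
  "directed b1 b2 s [] = []"
| "directed b1 b2 s (X1 # w) = s X1 # rooted b1 w"
| "directed b1 b2 s (X2 # w) = s X2 # rooted b2 w"
| "directed b1 b2 s (X3 # w) = s X3 # directed b1 b2 s w"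

definition S3_image :: "(word \<Rightarrow> word) set" where
  "S3_image = {rooted a | a. a permutes UNIV}"

definition B3_image :: "(word \<Rightarrow> word) set" where
  "B3_image = {directed b1 b2 s | b1 b2 s.
     b1 permutes UNIV \<and> b2 permutes UNIV \<and> s permutes {X1, X2}}"

definition mother_group :: "(word \<Rightarrow> word) monoid" where
  "mother_group = subgroup_generated tree_aut (S3_image \<union> B3_image)"

lemma group_tree_aut: "group tree_aut"
proof (rule groupI)
  fix g assume "g \<in> carrier tree_aut"
  then have g: "bij g" "g [] = []" "\<And>u v. tree_adj (g u) (g v) \<longleftrightarrow> tree_adj u v"
    by (auto simp: tree_aut_def)
  have gi: "g (inv_into UNIV g u) = u" for u
    using g(1) by (simp add: bij_is_surj surj_f_inv_f)
  have "inv_into UNIV g \<in> carrier tree_aut"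
    using g gi by (auto simp: tree_aut_def bij_imp_bij_inv)
      (metis bij_is_inj inv_f_f gi)+
  moreover have "inv_into UNIV g \<otimes>\<^bsub>tree_aut\<^esub> g = \<one>\<^bsub>tree_aut\<^esub>"
    using gi by (auto simp: tree_aut_def)
  ultimately show "\<exists>h\<in>carrier tree_aut. h \<otimes>\<^bsub>tree_aut\<^esub> g = \<one>\<^bsub>tree_aut\<^esub>"
    by blast
qed (auto simp: tree_aut_def bij_comp o_assoc)

lemma tree_autI:
  assumes "inj f" "surj f" "f [] = []" and ext: "\<And>u x. \<exists>y. f (u @ [x]) = f u @ [y]"
  shows "f \<in> carrier tree_aut"
proof -
  have *: "(\<exists>y. f v = f u @ [y]) \<longleftrightarrow> (\<exists>x. v = u @ [x])" for u v
  proof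
    assume "\<exists>y. f v = f u @ [y]"
    then obtain y where y: "f v = f u @ [y]" ..
    then have "v \<noteq> []" using assms(3) by auto
    then obtain v' x where v: "v = v' @ [x]" by (metis append_butlast_last_id)
    then have "f v' = f u" using ext[of v' x] y by auto
    then show "\<exists>x. v = u @ [x]" using v \<open>inj f\<close> by (auto dest: injD)
  qed (use ext in auto)
  have "tree_adj (f u) (f v) \<longleftrightarrow> tree_adj u v" for u v
    unfolding tree_adj_def using *[of u v] *[of v u] by blast
  then show ?thesis using assms by (simp add: tree_aut_def bij_def)
qed

lemma inj_surj_rooted:
  assumes "a permutes UNIV"
  shows "inj (rooted a)" "surj (rooted a)"
proof -
  have a: "inj a" "surj a"
    using assms permutes_inj permutes_surj by blast+
  have "u = v" if "rooted a u = rooted a v" for u v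
    using that a(1) by (cases u; cases v) (auto dest: injD)
  then show "inj (rooted a)" by (simp add: inj_def)
  have "\<exists>u. v = rooted a u" for v
  proof (cases v)
    case (Cons y w)
    obtain x where "y = a x" using a(2) by (metis surj_def)
    then show ?thesis using Cons by (intro exI[of _ "x # w"]) simp
  qed (auto intro: exI[of _ "[]"])
  then show "surj (rooted a)" by (simp add: surj_def)
qed

lemma rooted_snoc: "\<exists>y. rooted a (u @ [x]) = rooted a u @ [y]"
  by (cases u) auto

lemma S3_image_subset: "S3_image \<subseteq> carrier tree_aut"
  by (auto simp: S3_image_def intro!: tree_autI inj_surj_rooted rooted_snoc)

lemma directed_in_tree_aut:
  assumes "b1 permutes UNIV" "b2 permutes UNIV" "s permutes UNIV"
  shows "directed b1 b2 s \<in> carrier tree_aut"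
proof (rule tree_autI)
  note r1 = inj_surj_rooted[OF assms(1)] and r2 = inj_surj_rooted[OF assms(2)]
  have s: "inj s" "surj s"
    using assms(3) permutes_inj permutes_surj by blast+
  have "directed b1 b2 s u = directed b1 b2 s v \<Longrightarrow> u = v" for u v
  proof (induction u arbitrary: v)
    case Nil
    then show ?case by (cases "(b1, b2, s, v)" rule: directed.cases) auto
  next
    case (Cons x u)
    then obtain y w where v: "v = y # w"
      by (cases v; cases x) auto
    have "s x = s y" using Cons.prems v by (cases x; cases y) auto
    then have "x = y" using s(1) by (auto dest: injD)
    then show ?case
      using Cons v r1(1) r2(1) by (cases x) (auto dest: injD)
  qed
  then show "inj (directed b1 b2 s)" by (simp add: inj_def)
  have "\<exists>u. v = directed b1 b2 s u" for v
  proof (induction v)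
    case Nil
    show ?case by (rule exI[of _ "[]"]) simp
  next
    case (Cons y v)
    obtain x where x: "y = s x" using s(2) by (metis surj_def)
    obtain u1 u2 where "v = rooted b1 u1" "v = rooted b2 u2"
      using r1(2) r2(2) by (metis surj_def)
    then show ?case using x Cons by (cases x) (metis directed.simps)+
  qed
  then show "surj (directed b1 b2 s)" by (simp add: surj_def)
  show "\<exists>y. directed b1 b2 s (u @ [x]) = directed b1 b2 s u @ [y]" for u x
  proof (induction u)
    case Nil
    then show ?case by (cases x) auto
  next
    case (Cons z u)
    then show ?case
      using rooted_snoc[of b1 u x] rooted_snoc[of b2 u x] by (cases z) auto
  qed
qed simp

lemma B3_image_subset: "B3_image \<subseteq> carrier tree_aut"
  by (auto simp: B3_image_def intro!: directed_in_tree_aut intro: permutes_subset)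


section \<open>Proper length metrics\<close>

definition length_function :: "('a, 'b) monoid_scheme \<Rightarrow> ('a \<Rightarrow> real) \<Rightarrow> bool" where
  "length_function G l \<longleftrightarrow>
     (\<forall>g\<in>carrier G. 0 \<le> l g) \<and>
     (\<forall>g\<in>carrier G. l g = 0 \<longleftrightarrow> g = \<one>\<^bsub>G\<^esub>) \<and>
     (\<forall>g\<in>carrier G. l (inv\<^bsub>G\<^esub> g) = l g) \<and>
     (\<forall>g\<in>carrier G. \<forall>h\<in>carrier G. l (g \<otimes>\<^bsub>G\<^esub> h) \<le> l g + l h)"

definition proper_length_function :: "('a, 'b) monoid_scheme \<Rightarrow> ('a \<Rightarrow> real) \<Rightarrow> bool" where
  "proper_length_function G l \<longleftrightarrow>
     length_function G l \<and> (\<forall>R. finite {g \<in> carrier G. l g \<le> R})"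

text \<open>The library's type of metric spaces wants distances that are nonnegative and symmetric
  on the whole type, hence the value \<open>0\<close> outside the carrier.\<close>

definition length_dist :: "('a, 'b) monoid_scheme \<Rightarrow> ('a \<Rightarrow> real) \<Rightarrow> 'a \<Rightarrow> 'a \<Rightarrow> real" where
  "length_dist G l g h =
     (if g \<in> carrier G \<and> h \<in> carrier G then l (g \<otimes>\<^bsub>G\<^esub> inv\<^bsub>G\<^esub> h) else 0)"

definition length_metric :: "('a, 'b) monoid_scheme \<Rightarrow> ('a \<Rightarrow> real) \<Rightarrow> 'a metric" where
  "length_metric G l = metric (carrier G, length_dist G l)"

lemma Metric_space_length_dist:
  assumes "group G" "length_function G l"
  shows "Metric_space (carrier G) (length_dist G l)"
proof -
  interpret group G by fact
  note l = assms(2)[unfolded length_function_def]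
  show ?thesis
  proof
    show "0 \<le> length_dist G l x y" for x y
      using l by (auto simp: length_dist_def)
    show "length_dist G l x y = length_dist G l y x" for x y
    proof (cases "x \<in> carrier G \<and> y \<in> carrier G")
      case True
      then have "inv\<^bsub>G\<^esub> (x \<otimes>\<^bsub>G\<^esub> inv\<^bsub>G\<^esub> y) = y \<otimes>\<^bsub>G\<^esub> inv\<^bsub>G\<^esub> x"
        by (simp add: inv_mult_group)
      then show ?thesis
        using l True by (metis length_dist_def inv_closed m_closed)
    qed (auto simp: length_dist_def)
    show "length_dist G l x y = 0 \<longleftrightarrow> x = y" if "x \<in> carrier G" "y \<in> carrier G" for x y
    proof -
      have "x \<otimes>\<^bsub>G\<^esub> inv\<^bsub>G\<^esub> y = \<one>\<^bsub>G\<^esub> \<longleftrightarrow> x = y"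
        using that by (metis inv_closed inv_equality inv_inv r_inv)
      then show ?thesis using l that by (simp add: length_dist_def)
    qed
    show "length_dist G l x z \<le> length_dist G l x y + length_dist G l y z"
      if "x \<in> carrier G" "y \<in> carrier G" "z \<in> carrier G" for x y z
    proof -
      have "x \<otimes>\<^bsub>G\<^esub> inv\<^bsub>G\<^esub> z = (x \<otimes>\<^bsub>G\<^esub> inv\<^bsub>G\<^esub> y) \<otimes>\<^bsub>G\<^esub> (y \<otimes>\<^bsub>G\<^esub> inv\<^bsub>G\<^esub> z)"
        using that by (metis inv_closed inv_solve_left m_assoc m_closed)
      then show ?thesis using l that by (simp add: length_dist_def)
    qed
  qed
qed


section \<open>Asymptotic dimension and decomposition complexity\<close>

text \<open>The infimum is taken in the extended reals, so that it is infinite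
  if one of the two sets is empty.\<close>

definition r_disjoint :: "'a metric \<Rightarrow> real \<Rightarrow> 'a set set \<Rightarrow> bool" where
  "r_disjoint m r \<U> \<longleftrightarrow>
     (\<forall>U\<in>\<U>. \<forall>U'\<in>\<U>. U \<noteq> U' \<longrightarrow> (INF x\<in>U. INF x'\<in>U'. ereal (mdist m x x')) > ereal r)"

text \<open>A metric family is a set of metric spaces.\<close>

definition bounded_family :: "'a metric set \<Rightarrow> bool" where
  "bounded_family \<X> \<longleftrightarrow> (\<exists>C. \<forall>m\<in>\<X>. \<forall>x\<in>mspace m. \<forall>y\<in>mspace m. mdist m x y \<le> C)"

definition asdim_le :: "'a metric \<Rightarrow> nat \<Rightarrow> bool" where
  "asdim_le m n \<longleftrightarrow>
     (\<forall>r>0. \<exists>\<U> :: nat \<Rightarrow> 'a set set.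
        mspace m = (\<Union>i\<le>n. \<Union>(\<U> i)) \<and>
        (\<forall>i\<le>n. r_disjoint m r (\<U> i)) \<and>
        bounded_family {submetric m U | U. \<exists>i\<le>n. U \<in> \<U> i})"

definition asdim_infinite :: "'a metric \<Rightarrow> bool" where
  "asdim_infinite m \<longleftrightarrow> (\<nexists>n. asdim_le m n)"

definition r_decomposable :: "real \<Rightarrow> 'a metric set \<Rightarrow> 'a metric set \<Rightarrow> bool" where
  "r_decomposable r \<X> \<Y> \<longleftrightarrow>
     (\<forall>Z\<in>\<X>. \<exists>\<U>0 \<U>1.
        mspace Z = \<Union>\<U>0 \<union> \<Union>\<U>1 \<and>
        r_disjoint Z r \<U>0 \<and> r_disjoint Z r \<U>1 \<and>
        (\<forall>U\<in>\<U>0 \<union> \<U>1. submetric Z U \<in> \<Y>))"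

text \<open>The classes \<open>\<D>\<^sub>\<alpha>\<close>, for \<open>\<alpha>\<close> ranging over a well-ordered type whose elements stand for the
  ordinals below its order type, with \<open>bot\<close> as the ordinal zero. The type \<^typ>\<open>enat\<close> has order
  type \<open>\<omega> + 1\<close>, and its element \<open>\<infinity>\<close> is the ordinal \<open>\<omega>\<close>.\<close>

declare conj_cong [fundef_cong]

function decomp_class :: "'o::{wellorder, order_bot} \<Rightarrow> 'a metric set set" where
  "decomp_class \<alpha> =
     (if \<alpha> = bot then {\<X>. bounded_family \<X>}
      else {\<X>. \<forall>r>0. \<exists>\<beta><\<alpha>. \<exists>\<Y>\<in>decomp_class \<beta>. r_decomposable r \<X> \<Y>})"
  by auto
termination
  by (relation "{(x, y). x < y}") (auto simp: wf)

declare conj_cong [fundef_cong del]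
declare decomp_class.simps [simp del]

lemma decomp_class_0: "decomp_class (0::enat) = {\<X>. bounded_family \<X>}"
  by (simp add: decomp_class.simps bot_enat_def)

lemma decomp_class_omega:
  "decomp_class (\<infinity>::enat) =
     {\<X>. \<forall>r>0. \<exists>n. \<exists>\<Y>\<in>decomp_class (enat n). r_decomposable r \<X> \<Y>}"
  by (subst decomp_class.simps)
    (auto simp: bot_enat_def less_infinityE, metis less_infinityE, metis enat_ord_simps(4))

end

theory Submission
  imports Defs
begin

text \<open>The subgroup is a copy of the free abelian group of countably infinite rank, that is, of the
group of integer sequences with finite support.

\<^emph>\<open>Inside the mother group.\<close> Let \<open>x\<close> be the rooted automorphism of the transposition \<open>(1 3)\<close>, let
\<open>b = (x,1,b)\<close> and \<open>u = bx\<close>. Then \<open>u\<^sup>2 = (u\<^sup>-\<^sup>1,1,u)\<close>, which forces \<open>u\<close> to have infinite order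
(\<open>rotation_infinite_order\<close>). The commutator trick of branch groups moves \<open>g = u\<^sup>2 = [b,x]\<close> down
the tree: if \<open>h\<close> has a lift \<open>(1,y,h)\<close>, then \<open>[(x,1,b),(1,y,h)] = (1,1,[b,h])\<close>. As lifts can be
lifted again, \<open>[b,h]\<close> stays in the group after being pushed below \<open>3\<close> any number of times
(\<open>deep_commutator\<close>), and conjugation makes copies of \<open>g\<close> act below the pairwise incomparable
vertices \<open>1, 31, 331, \<dots>\<close>. These copies commute and are independent, hence generate the
group of all \<open>(g\<^bsup>f 0\<^esup>, 1, (g\<^bsup>f 1\<^esup>, 1, \<dots>))\<close> with \<open>f\<close> of finite support (\<open>spread_deep\<close>).

\<^emph>\<open>The decomposition complexity.\<close> A ball of a proper length function is finite, so it lies in the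
subgroup \<open>\<int>\<^sup>N\<close> of the first \<open>N\<close> coordinates for some \<open>N\<close>; cosets of this subgroup are then far apart.
The family of these cosets is in the class \<open>N\<close>: cutting along a coordinate into long intervals,
alternately put into two families, bounds that coordinate at the cost of one step
(\<open>slices_decomposable\<close>).

\<^emph>\<open>The asymptotic dimension.\<close> A cover of \<open>\<int>\<^sup>d\<close> by \<open>d\<close> families of bounded, pairwise distant sets
would give a cover of a large cube by sets that miss one of any two opposite faces. Lebesgue's
covering theorem yields \<open>d + 1\<close> of these sets with points in one unit cell
(\<open>lebesgue_covering_cube\<close>), two of which are in the same family although they are close.\<close>

section \<open>Lebesgue covering theorem on a grid\<close>

text \<open>A form of Lebesgue's covering theorem on the grid \<open>{0,\<dots>,p}\<^sup>d\<close>, where \<open>U x\<close> names the set of the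
cover chosen for the point \<open>x\<close>. Label \<open>x\<close> in direction \<open>j\<close> by whether \<open>U x\<close> meets the face
\<open>x\<^sub>j = 0\<close>. This depends on \<open>U x\<close> only and is a labelling as in Kuhn's combinatorial lemma, which gives a
simplex whose vertices carry all \<open>d + 1\<close> reduced labels, hence lie in \<open>d + 1\<close> different sets.\<close>

lemma lebesgue_covering_cube:
  fixes U :: "(nat \<Rightarrow> nat) \<Rightarrow> 'u"
  assumes "0 < p"
    and faces: "\<And>x y j. \<forall>i. x i \<le> p \<Longrightarrow> \<forall>i. y i \<le> p \<Longrightarrow> j < d \<Longrightarrow> x j = 0 \<Longrightarrow> y j = p \<Longrightarrow> U x \<noteq> U y"
  obtains v :: "nat \<Rightarrow> nat \<Rightarrow> nat" where
    "\<And>j i. j \<le> d \<Longrightarrow> v j i \<le> p"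
    "inj_on (U \<circ> v) {..d}"
    "\<And>j k i. j \<le> d \<Longrightarrow> k \<le> d \<Longrightarrow> v j i \<le> v k i + 1"
proof -
  define lab :: "(nat \<Rightarrow> nat) \<Rightarrow> nat \<Rightarrow> nat" where
    "lab x j = (if \<exists>y. (\<forall>i. y i \<le> p) \<and> y j = 0 \<and> U y = U x then 0 else 1)" for x j
  have "odd (card {s. ksimplex p d s \<and> (reduced d \<circ> lab) ` s = {..d}})"
  proof (intro kuhn_combinatorial allI impI)
    show "lab x j = 0" if "(\<forall>j. x j \<le> p) \<and> j < d \<and> x j = 0" for x j
      using that by (auto simp: lab_def)
    show "lab x j = 1" if "(\<forall>j. x j \<le> p) \<and> j < d \<and> x j = p" for x j
      using that faces[of _ x j] unfolding lab_def by metis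
  qed fact
  from odd_card_imp_not_empty[OF this]
  obtain s where s: "ksimplex p d s" and labs: "(reduced d \<circ> lab) ` s = {..d}"
    by blast
  have "\<forall>j\<in>{..d}. \<exists>x\<in>s. reduced d (lab x) = j"
    using labs by (auto simp: image_iff set_eq_iff) (metis comp_apply)
  then obtain v where v: "\<And>j. j \<le> d \<Longrightarrow> v j \<in> s \<and> reduced d (lab (v j)) = j"
    by (metis atMost_iff)
  obtain b upd where ks: "kuhn_simplex p d b upd s"
    using s by (auto elim: ksimplex.cases)
  interpret kuhn_simplex p d b upd s by (fact ks)
  \<comment> \<open>Every vertex of a Kuhn simplex is obtained from the base point by raising some coordinates by one.\<close>
  have near: "b i \<le> x i \<and> x i \<le> b i + 1" if "x \<in> s" for x i
    using that by (auto simp: s_pre)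
  have "x i \<le> p" if "x \<in> s" for x i
  proof (cases "i < d")
    case True
    then show ?thesis using s_space that by auto
  next
    case False
    \<comment> \<open>Beyond the first \<open>d\<close> coordinates the vertices of a Kuhn simplex are constantly \<open>p\<close>.\<close>
    have "x \<in> enum ` {..d}" using that by (simp only: s_eq)
    then obtain k where "k \<le> d" and x: "x = enum k" by auto
    have "i \<notin> upd ` {..<k}"
    proof
      assume "i \<in> upd ` {..<k}"
      then obtain m where "m < k" "i = upd m" by auto
      then show False using upd_space[of m] \<open>k \<le> d\<close> False by simp
    qed
    then have "x i = b i" by (simp add: x enum_def)
    then show ?thesis using base_out[of i] False by simp
  qed
  moreover have "inj_on (U \<circ> v) {..d}"
  proof (rule inj_onI)
    fix j k assume jk: "j \<in> {..d}" "k \<in> {..d}" "(U \<circ> v) j = (U \<circ> v) k"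
    then have "U (v j) = U (v k)" by simp
    then have "lab (v j) = lab (v k)" unfolding lab_def by presburger
    moreover have "reduced d (lab (v j)) = j" "reduced d (lab (v k)) = k"
      using jk by (simp_all add: v)
    ultimately show "j = k" by argo
  qed
  moreover have "v j i \<le> v k i + 1" if "j \<le> d" "k \<le> d" for j k i
  proof -
    have "v j \<in> s" "v k \<in> s" using that v by blast+
    then show ?thesis using near[of "v j" i] near[of "v k" i] by linarith
  qed
  ultimately show ?thesis using v by (intro that[of v]) blast+
qed

section \<open>Finitely supported integer sequences\<close>

definition finsupp :: "(nat \<Rightarrow> int) set" where
  "finsupp = {f. \<exists>N. \<forall>i\<ge>N. f i = 0}"

lemma finsupp_zero: "(\<lambda>i. 0) \<in> finsupp"
  by (auto simp: finsupp_def)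

lemma finsupp_update: "f \<in> finsupp \<Longrightarrow> f(k := n) \<in> finsupp"
proof -
  assume "f \<in> finsupp"
  then obtain N where "\<forall>i\<ge>N. f i = 0" by (auto simp: finsupp_def)
  then have "\<forall>i\<ge>max N (Suc k). (f(k := n)) i = 0" by auto
  then show ?thesis unfolding finsupp_def by blast
qed

lemma finsupp_lin:
  assumes "f \<in> finsupp" "h \<in> finsupp"
  shows "(\<lambda>i. f i + h i) \<in> finsupp" "(\<lambda>i. f i - h i) \<in> finsupp" "(\<lambda>i. - f i) \<in> finsupp"
proof -
  obtain N M where "\<forall>i\<ge>N. f i = 0" "\<forall>i\<ge>M. h i = 0" 
    using assms by (auto simp: finsupp_def)
  then have "\<forall>i\<ge>max N M. f i = 0 \<and> h i = 0" by auto
  then show "(\<lambda>i. f i + h i) \<in> finsupp" "(\<lambda>i. f i - h i) \<in> finsupp" "(\<lambda>i. - f i) \<in> finsupp"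
    unfolding finsupp_def by fastforce+
qed

text \<open>Only finitely many coordinates are free, and each of them ranges over a finite interval.\<close>

lemma finite_finsupp_box:
  assumes "c \<in> finsupp"
  shows "finite {f. \<forall>i. \<bar>f i\<bar> \<le> c i}"
proof -
  obtain N where N: "\<forall>i\<ge>N. c i = 0" using assms by (auto simp: finsupp_def)
  define C where "C = Max (c ` {..N})"
  have C: "c i \<le> C" if "i < N" for i
    using that unfolding C_def by (intro Max_ge) auto
  have *: "\<bar>f i\<bar> \<le> C" if "i < N" "\<forall>i. \<bar>f i\<bar> \<le> c i" for f :: "nat \<Rightarrow> int" and i
    using C[of i] that by (meson order_trans)
  have "{f. \<forall>i. \<bar>f i\<bar> \<le> c i} \<subseteq>
      {f. \<forall>i. (i \<in> {..<N} \<longrightarrow> f i \<in> {-C..C}) \<and> (i \<notin> {..<N} \<longrightarrow> f i = 0)}"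
  proof (intro subsetI CollectI allI conjI impI)
    fix f i assume f: "f \<in> {f. \<forall>i. \<bar>f i\<bar> \<le> c i}"
    show "f i \<in> {-C..C}" if "i \<in> {..<N}" using *[of i f] f that by (simp add: abs_le_iff)
    show "f i = 0" if "i \<notin> {..<N}"
    proof -
      have "\<bar>f i\<bar> \<le> c i" using f by blast
      moreover have "c i = 0" using N that by simp
      ultimately show ?thesis by simp
    qed
  qed
  then show ?thesis
    by (rule finite_subset) (rule finite_set_of_finite_funs; simp)
qed

section \<open>Metric geometry of proper length functions in integer coordinates\<close>

text \<open>A group with a proper length function that is identified by \<open>\<phi>\<close> with the finitely supported
integer sequences. All metric arguments take place here.\<close>

locale integer_coordinates = group G for G (structure) +
  fixes \<phi> :: "(nat \<Rightarrow> int) \<Rightarrow> 'a" and l :: "'a \<Rightarrow> real"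
  assumes bij: "bij_betw \<phi> finsupp (carrier G)"
    and hom: "\<And>f h. f \<in> finsupp \<Longrightarrow> h \<in> finsupp \<Longrightarrow> \<phi> (\<lambda>i. f i + h i) = \<phi> f \<otimes> \<phi> h"
    and proper: "proper_length_function G l"
begin

abbreviation "M \<equiv> length_metric G l"

lemma in_carrier: "f \<in> finsupp \<Longrightarrow> \<phi> f \<in> carrier G"
  using bij by (auto simp: bij_betw_def)

lemma inj: "inj_on \<phi> finsupp"
  using bij by (simp add: bij_betw_def)

lemma space: "mspace M = \<phi> ` finsupp"
proof -
  interpret Metric_space "carrier G" "length_dist G l"
    using Metric_space_length_dist[of G l] proper is_group
    by (simp add: proper_length_function_def)
  show ?thesis using bij by (simp add: length_metric_def bij_betw_def)
qed

text \<open>The distance is invariant under translation, so balls about the origin control everything.\<close>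

lemma dist:
  assumes "f \<in> finsupp" "h \<in> finsupp"
  shows "mdist M (\<phi> f) (\<phi> h) = l (\<phi> (\<lambda>i. f i - h i))"
proof -
  interpret Metric_space "carrier G" "length_dist G l"
    using Metric_space_length_dist[of G l] proper is_group
    by (simp add: proper_length_function_def)
  have "\<phi> (\<lambda>i. f i - h i) \<otimes> \<phi> h = \<phi> f"
    using hom[of "\<lambda>i. f i - h i" h] finsupp_lin assms by simp
  then have "\<phi> f \<otimes> inv (\<phi> h) = \<phi> (\<lambda>i. f i - h i)"
    by (metis assms finsupp_lin(2) in_carrier inv_solve_right)
  then show ?thesis
    using assms by (simp add: length_metric_def length_dist_def in_carrier)
qed

lemma finite_ball: "finite {f \<in> finsupp. l (\<phi> f) \<le> R}"
proof -
  have "finite {g \<in> carrier G. l g \<le> R}"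
    using proper by (simp add: proper_length_function_def)
  then have "finite (\<phi> ` {f \<in> finsupp. l (\<phi> f) \<le> R})"
    by (rule rev_finite_subset) (auto simp: in_carrier)
  then show ?thesis
    by (rule finite_imageD) (auto intro: inj_on_subset[OF inj])
qed

lemma ball_coordinate_bound:
  "\<exists>P>0. \<forall>f\<in>finsupp. l (\<phi> f) \<le> R \<longrightarrow> \<bar>f i\<bar> < (P::int)"
proof -
  have "finite ((\<lambda>f. \<bar>f i\<bar>) ` {f \<in> finsupp. l (\<phi> f) \<le> R})"
    using finite_ball by simp
  from bdd_above_finite[OF this]
  obtain P where "\<And>f. f \<in> finsupp \<Longrightarrow> l (\<phi> f) \<le> R \<Longrightarrow> \<bar>f i\<bar> \<le> P"
    by (auto simp: bdd_above_def)
  then have "\<forall>f\<in>finsupp. l (\<phi> f) \<le> R \<longrightarrow> \<bar>f i\<bar> < max 1 (P + 1)"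
    by (simp add: less_max_iff_disj)
  then show ?thesis by (intro exI[of _ "max 1 (P + 1)"]) simp
qed

lemma ball_support_bound:
  "\<exists>N. \<forall>f\<in>finsupp. l (\<phi> f) \<le> R \<longrightarrow> (\<forall>i\<ge>N. f i = 0)"
proof -
  have "\<forall>f\<in>{f \<in> finsupp. l (\<phi> f) \<le> R}. \<exists>N. \<forall>i\<ge>N. f i = 0"
    by (auto simp: finsupp_def)
  then obtain N where N: "\<forall>f\<in>{f \<in> finsupp. l (\<phi> f) \<le> R}. \<forall>i\<ge>N f. f i = 0"
    by metis
  show ?thesis
  proof (intro exI[of _ "Max (N ` {f \<in> finsupp. l (\<phi> f) \<le> R})"] ballI impI allI)
    fix f i assume f: "f \<in> finsupp" "l (\<phi> f) \<le> R"
      and i: "Max (N ` {f \<in> finsupp. l (\<phi> f) \<le> R}) \<le> i"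
    have "N f \<le> Max (N ` {f \<in> finsupp. l (\<phi> f) \<le> R})"
      using f finite_ball by (intro Max_ge) auto
    with i have "N f \<le> i" by linarith
    then show "f i = 0" using N f by blast
  qed
qed

text \<open>Families of pieces of uniformly bounded width in the coordinates from \<open>n\<close> on, and of arbitrary
width in the first \<open>n\<close> ones. For \<open>c = 0\<close> the largest members are the cosets of \<open>\<int>\<^sup>n\<close>; allowing a
positive \<open>c\<close> is what makes the induction on \<open>n\<close> close without any appeal to coarse
equivalence.\<close>

definition slices :: "nat \<Rightarrow> (nat \<Rightarrow> int) \<Rightarrow> 'a metric set" where
  "slices n c = {submetric M (\<phi> ` A) | A. A \<subseteq> finsupp \<and>
     (\<forall>f\<in>A. \<forall>h\<in>A. \<forall>i\<ge>n. \<bar>f i - h i\<bar> \<le> c i)}"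

text \<open>The margin \<open>1\<close> is there because the infimum of the distances has to exceed \<open>r\<close> strictly.\<close>

lemma r_disjoint_fibres:
  assumes "\<And>f h. f \<in> A \<Longrightarrow> h \<in> A \<Longrightarrow> k f \<in> S \<Longrightarrow> k h \<in> S \<Longrightarrow> k f \<noteq> k h \<Longrightarrow> r + 1 \<le> mdist Z (\<phi> f) (\<phi> h)"
  shows "r_disjoint Z r {\<phi> ` {f\<in>A. k f = t} | t. t \<in> S}"
  unfolding r_disjoint_def
proof (intro ballI impI)
  fix U U' assume "U \<in> {\<phi> ` {f\<in>A. k f = t} | t. t \<in> S}" "U' \<in> {\<phi> ` {f\<in>A. k f = t} | t. t \<in> S}"
    and ne: "U \<noteq> U'"
  then obtain t t' where U: "U = \<phi> ` {f\<in>A. k f = t}" "U' = \<phi> ` {f\<in>A. k f = t'}"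
    and t: "t \<in> S" "t' \<in> S"
    by blast
  with ne have "t \<noteq> t'" by auto
  have "ereal (r + 1) \<le> (INF x\<in>U. INF x'\<in>U'. ereal (mdist Z x x'))"
    unfolding U using t \<open>t \<noteq> t'\<close> by (intro INF_greatest) (auto intro!: assms)
  then show "ereal r < (INF x\<in>U. INF x'\<in>U'. ereal (mdist Z x x'))"
    by (rule less_le_trans[rotated]) simp
qed

lemma bounded_slices:
  assumes "c \<in> finsupp"
  shows "bounded_family (slices 0 c)"
proof -
  define D where "D = {f. \<forall>i. \<bar>f i\<bar> \<le> c i}"
  have "finite ((\<lambda>f. l (\<phi> f)) ` D)"
    using finite_finsupp_box[OF assms] by (simp add: D_def)
  from bdd_above_finite[OF this]
  obtain C where C: "\<And>f. f \<in> D \<Longrightarrow> l (\<phi> f) \<le> C"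
    by (auto simp: bdd_above_def)
  show ?thesis
    unfolding bounded_family_def slices_def
  proof (intro exI[of _ C] ballI)
    fix m x y
    assume "m \<in> {submetric M (\<phi> ` A) | A. A \<subseteq> finsupp \<and>
        (\<forall>f\<in>A. \<forall>h\<in>A. \<forall>i\<ge>0. \<bar>f i - h i\<bar> \<le> c i)}"
      and xy: "x \<in> mspace m" "y \<in> mspace m"
    then obtain A where m: "m = submetric M (\<phi> ` A)" and A: "A \<subseteq> finsupp"
      and w: "\<forall>f\<in>A. \<forall>h\<in>A. \<forall>i. \<bar>f i - h i\<bar> \<le> c i"
      by auto
    obtain f h where "f \<in> A" "h \<in> A" "x = \<phi> f" "y = \<phi> h"
      using xy m by auto
    then show "mdist m x y \<le> C"
      using A w by (auto simp: m D_def subset_iff dist intro!: C)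
  qed
qed

text \<open>One step of decomposition pays for one coordinate: a large move in coordinate \<open>n\<close> is a large move
in the group, so pieces cut out by intervals of length \<open>P\<close> in that coordinate are far apart
if the intervals are not adjacent.\<close>

lemma slices_decomposable:
  assumes "c \<in> finsupp"
  shows "slices n c \<in> decomp_class (enat n)"
  using assms
proof (induction n arbitrary: c)
  case 0
  then show ?case
    using bounded_slices by (simp add: zero_enat_def[symmetric] decomp_class_0)
next
  case (Suc n)
  have "\<exists>\<beta><enat (Suc n). \<exists>\<Y>\<in>decomp_class \<beta>. r_decomposable r (slices (Suc n) c) \<Y>" for r
  proof -
    obtain P where P: "P > 0" "\<And>f. f \<in> finsupp \<Longrightarrow> l (\<phi> f) \<le> r + 1 \<Longrightarrow> \<bar>f n\<bar> < P"
      using ball_coordinate_bound by blast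
    have "r_decomposable r (slices (Suc n) c) (slices n (c(n := P)))"
      unfolding r_decomposable_def
    proof
      fix Z assume "Z \<in> slices (Suc n) c"
      then obtain A where Z: "Z = submetric M (\<phi> ` A)" and A: "A \<subseteq> finsupp"
        and w: "\<And>f h i. f \<in> A \<Longrightarrow> h \<in> A \<Longrightarrow> i \<ge> Suc n \<Longrightarrow> \<bar>f i - h i\<bar> \<le> c i"
        by (auto simp: slices_def)
      \<comment> \<open>The number of the interval; even and odd intervals form the two families.\<close>
      define k where "k f = f n div P" for f :: "nat \<Rightarrow> int"
      define V where "V S = {\<phi> ` {f\<in>A. k f = t} | t. t \<in> S}" for S
      have disj: "r_disjoint Z r (V S)" if S: "\<And>s t. s \<in> S \<Longrightarrow> t \<in> S \<Longrightarrow> even (s - t)" for S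
        unfolding V_def
      proof (rule r_disjoint_fibres)
        fix f h assume fh: "f \<in> A" "h \<in> A" "k f \<in> S" "k h \<in> S" "k f \<noteq> k h"
        have "\<not> \<bar>k f - k h\<bar> \<le> 1"
          using S[OF fh(3,4)] fh(5) by presburger
        have "P \<le> \<bar>f n - h n\<bar>"
        proof (rule ccontr)
          assume "\<not> ?thesis"
          then have "f n < h n + P" "h n < f n + P" by auto
          with P(1) have "f n div P \<le> (h n + P) div P" "h n div P \<le> (f n + P) div P"
            by (intro zdiv_mono1; linarith)+
          then show False using \<open>\<not> \<bar>k f - k h\<bar> \<le> 1\<close> P(1) by (simp add: k_def)
        qed
        moreover have "f \<in> finsupp" "h \<in> finsupp" using fh A by auto
        ultimately show "r + 1 \<le> mdist Z (\<phi> f) (\<phi> h)"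
          using P(2)[of "\<lambda>i. f i - h i"] finsupp_lin(2)[of f h] by (force simp: Z dist)
      qed
      have piece: "submetric Z U \<in> slices n (c(n := P))" if UV: "U \<in> V S" for U S
      proof -
        obtain t where U: "U = \<phi> ` {f\<in>A. k f = t}"
          using UV unfolding V_def by blast
        have "\<phi> ` A \<inter> U = U" using U by blast
        then have "submetric Z U = submetric M (\<phi> ` {f\<in>A. k f = t})"
          by (simp add: Z U)
        moreover have "\<bar>f i - h i\<bar> \<le> (c(n := P)) i"
          if fh: "f \<in> {f\<in>A. k f = t}" "h \<in> {f\<in>A. k f = t}" and "n \<le> i" for f h i
        proof (cases "i = n")
          case True
          have "f n = P * t + f n mod P" "h n = P * t + h n mod P"
            using fh mult_div_mod_eq[of P "f n"] mult_div_mod_eq[of P "h n"]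
            by (simp_all add: k_def)
          moreover have "0 \<le> f n mod P" "f n mod P < P" "0 \<le> h n mod P" "h n mod P < P"
            using P(1) by auto
          ultimately have "\<bar>f n - h n\<bar> \<le> P" by linarith
          then show ?thesis using True by simp
        next
          case False
          then show ?thesis using fh w[of f h i] \<open>n \<le> i\<close> by simp
        qed
        ultimately show ?thesis
          unfolding slices_def using A by (intro CollectI exI[of _ "{f\<in>A. k f = t}"]) auto
      qed
      have "mspace Z = \<phi> ` A"
        using A by (auto simp: Z space)
      also have "\<dots> = \<Union>(V {t. even t}) \<union> \<Union>(V {t. odd t})"
        unfolding V_def by blast
      finally show "\<exists>\<U>0 \<U>1. mspace Z = \<Union>\<U>0 \<union> \<Union>\<U>1 \<and> r_disjoint Z r \<U>0 \<and> r_disjoint Z r \<U>1 \<and>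
          (\<forall>U\<in>\<U>0 \<union> \<U>1. submetric Z U \<in> slices n (c(n := P)))"
        using disj[of "{t. even t}"] disj[of "{t. odd t}"] piece
        by (intro exI[of _ "V {t. even t}"] exI[of _ "V {t. odd t}"]) auto
    qed
    moreover have "slices n (c(n := P)) \<in> decomp_class (enat n)"
      using Suc finsupp_update by blast
    ultimately show ?thesis by (intro exI[of _ "enat n"]) auto
  qed
  then show ?case
    by (subst decomp_class.simps) (simp add: bot_enat_def zero_enat_def)
qed

text \<open>The number of coordinates that the ball of radius \<open>r + 1\<close> uses is finite but grows with \<open>r\<close>; this is
why the class is indexed by \<open>\<omega>\<close>.\<close>

lemma decomp_class_omega_M: "{M} \<in> decomp_class (\<infinity>::enat)"
proof -
  have "\<exists>n. \<exists>\<Y>\<in>decomp_class (enat n). r_decomposable r {M} \<Y>" for r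
  proof -
    obtain N where N: "\<And>f i. f \<in> finsupp \<Longrightarrow> l (\<phi> f) \<le> r + 1 \<Longrightarrow> i \<ge> N \<Longrightarrow> f i = 0"
      using ball_support_bound by blast
    \<comment> \<open>The fibres of the tail map are the cosets of the group of the first coordinates.\<close>
    define k where "k f i = f (i + N)" for f :: "nat \<Rightarrow> int" and i
    let ?V = "{\<phi> ` {f\<in>finsupp. k f = t} | t. t \<in> UNIV}"
    have "r_disjoint M r ?V"
    proof (rule r_disjoint_fibres)
      fix f h assume fh: "f \<in> finsupp" "h \<in> finsupp" "k f \<noteq> k h"
      then obtain i where "f (i + N) \<noteq> h (i + N)" by (auto simp: k_def fun_eq_iff)
      then show "r + 1 \<le> mdist M (\<phi> f) (\<phi> h)"
        using N[of "\<lambda>i. f i - h i" "i + N"] finsupp_lin(2)[of f h] fh by (force simp: dist)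
    qed
    moreover have "mspace M = \<Union>?V" by (auto simp: space)
    moreover have "submetric M U \<in> slices N (\<lambda>i. 0)" if UV: "U \<in> ?V" for U
    proof -
      obtain t where U: "U = \<phi> ` {f\<in>finsupp. k f = t}" using UV by blast
      have "f i = h i" if "k f = k h" "i \<ge> N" for f h i
        using fun_cong[OF that(1), of "i - N"] that(2) by (simp add: k_def)
      then show ?thesis
        unfolding slices_def U by (intro CollectI exI[of _ "{f\<in>finsupp. k f = t}"]) auto
    qed
    moreover have "r_disjoint M r {}" by (simp add: r_disjoint_def)
    ultimately have "r_decomposable r {M} (slices N (\<lambda>i. 0))"
      unfolding r_decomposable_def by (intro ballI exI[of _ ?V] exI[of _ "{}"]) auto
    then show ?thesis using slices_decomposable[OF finsupp_zero] by blast
  qed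
  then show ?thesis by (simp add: decomp_class_omega)
qed

text \<open>With \<open>n + 1\<close> families of bounded sets, a cube of dimension \<open>n + 1\<close> that is longer than these
sets contradicts the covering theorem: two of the \<open>n + 2\<close> sets that it provides share a family.\<close>

lemma asdim_infinite_M: "asdim_infinite M"
  unfolding asdim_infinite_def
proof
  assume "\<exists>n. asdim_le M n"
  then obtain n where n: "asdim_le M n" ..
  define d where "d = Suc n"
  \<comment> \<open>The embedding of the grid as a coordinate cube.\<close>
  define e :: "(nat \<Rightarrow> nat) \<Rightarrow> nat \<Rightarrow> int" where "e x i = (if i < d then int (x i) else 0)" for x i
  have e: "e x \<in> finsupp" for x unfolding finsupp_def e_def by (auto intro: exI[of _ d])
  have "(\<lambda>i. if i < d then 1 else 0) \<in> finsupp" unfolding finsupp_def by (auto intro: exI[of _ d])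
  from finite_finsupp_box[OF this]
  have "finite ((\<lambda>f. l (\<phi> f)) ` {f. \<forall>i. \<bar>f i\<bar> \<le> (if i < d then 1 else 0)})" by simp
  from bdd_above_finite[OF this]
  obtain r0 where r0: "\<And>f. (\<forall>i. \<bar>f i\<bar> \<le> (if i < d then 1 else 0)) \<Longrightarrow> l (\<phi> f) \<le> r0"
    by (auto simp: bdd_above_def)
  \<comment> \<open>At this scale any two points of a unit cell of the cube are close.\<close>
  define r where "r = max r0 1"
  have "r > 0" by (simp add: r_def)
  from n[unfolded asdim_le_def, THEN spec, THEN mp, OF this]
  obtain \<U> :: "nat \<Rightarrow> 'a set set" where cover: "mspace M = (\<Union>i\<le>n. \<Union>(\<U> i))"
    and disj: "\<forall>i\<le>n. r_disjoint M r (\<U> i)"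
    and bdd: "bounded_family {submetric M U | U. \<exists>i\<le>n. U \<in> \<U> i}"
    by (elim exE conjE)
  from bdd obtain C where C': "\<forall>m\<in>{submetric M U | U. \<exists>i\<le>n. U \<in> \<U> i}.
      \<forall>x\<in>mspace m. \<forall>y\<in>mspace m. mdist m x y \<le> C"
    unfolding bounded_family_def by (elim exE)
  have C: "mdist M x y \<le> C"
    if "i \<le> n" "U \<in> \<U> i" "x \<in> U" "y \<in> U" "x \<in> mspace M" "y \<in> mspace M" for U i x y
  proof -
    have "submetric M U \<in> {submetric M U | U. \<exists>i\<le>n. U \<in> \<U> i}" using that by blast
    from bspec[OF C' this] show ?thesis using that by simp
  qed
  have "\<forall>i. \<exists>P>0. \<forall>f\<in>finsupp. l (\<phi> f) \<le> C \<longrightarrow> \<bar>f i\<bar> < (P::int)"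
    using ball_coordinate_bound by blast
  then obtain P where P: "\<And>i. P i > (0::int)" "\<And>i f. f \<in> finsupp \<Longrightarrow> l (\<phi> f) \<le> C \<Longrightarrow> \<bar>f i\<bar> < P i"
    by metis
  \<comment> \<open>The side of the cube: longer than every covering set in every direction.\<close>
  define p where "p = nat (Max (P ` {..d}))"
  have p: "P i \<le> int p" if "i \<le> d" for i
  proof -
    have "P i \<le> Max (P ` {..d})" using that by (intro Max_ge) auto
    then show ?thesis unfolding p_def by linarith
  qed
  have "0 < p" using P(1)[of 0] p[of 0] by simp
  have inM: "\<phi> (e x) \<in> mspace M" for x using e by (simp add: space)
  have "\<forall>x. \<exists>i U. i \<le> n \<and> U \<in> \<U> i \<and> \<phi> (e x) \<in> U"
  proof
    fix x
    from inM[of x, unfolded cover]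
    show "\<exists>i U. i \<le> n \<and> U \<in> \<U> i \<and> \<phi> (e x) \<in> U" by auto
  qed
  from this[unfolded choice_iff]
  obtain col U where U: "\<And>x. col x \<le> n" "\<And>x. U x \<in> \<U> (col x)" "\<And>x. \<phi> (e x) \<in> U x"
    by blast
  obtain v :: "nat \<Rightarrow> nat \<Rightarrow> nat" where v: "inj_on (U \<circ> v) {..d}"
    "\<And>j k i. j \<le> d \<Longrightarrow> k \<le> d \<Longrightarrow> v j i \<le> v k i + 1"
  proof (rule lebesgue_covering_cube[OF \<open>0 < p\<close>, of d U])
    fix x y :: "nat \<Rightarrow> nat" and j assume xy: "j < d" "x j = 0" "y j = p"
    show "U x \<noteq> U y"
    proof
      assume "U x = U y"
      then have "mdist M (\<phi> (e y)) (\<phi> (e x)) \<le> C"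
        using U(3)[of y] by (intro C[OF U(1)[of x] U(2)] U(3) inM) simp
      then have "\<bar>e y j - e x j\<bar> < P j"
        using P(2)[of "\<lambda>i. e y i - e x i" j] e finsupp_lin(2) by (auto simp: dist)
      then show False using p[of j] xy by (simp add: e_def)
    qed
  qed blast
  have "\<not> inj_on (col \<circ> v) {..d}"
  proof
    assume "inj_on (col \<circ> v) {..d}"
    then have "card {..d} \<le> card {..n}" using U(1) by (intro card_inj_on_le) auto
    then show False by (simp add: d_def)
  qed
  then obtain j k where jk: "j \<le> d" "k \<le> d" "j \<noteq> k" "col (v j) = col (v k)"
    by (auto simp: inj_on_def)
  have "\<bar>e (v j) i - e (v k) i\<bar> \<le> (if i < d then 1 else 0)" for i
    using v(2)[of j k i] v(2)[of k j i] jk by (auto simp: e_def)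
  then have le: "mdist M (\<phi> (e (v j))) (\<phi> (e (v k))) \<le> r"
    using r0[of "\<lambda>i. e (v j) i - e (v k) i"] e by (simp add: dist r_def)
  have "U (v j) = U (v k)"
  proof (rule ccontr)
    assume "U (v j) \<noteq> U (v k)"
    then have "ereal r < (INF x\<in>U (v j). INF x'\<in>U (v k). ereal (mdist M x x'))"
      using disj[rule_format, OF U(1)[of "v j"], unfolded r_disjoint_def, rule_format,
          OF U(2) U(2)[of "v k", folded jk(4)]] by blast
    also have "\<dots> \<le> ereal (mdist M (\<phi> (e (v j))) (\<phi> (e (v k))))"
      by (intro INF_lower2[OF U(3)] INF_lower2[OF U(3)] order_refl)
    finally show False using le by simp
  qed
  then show False using v(1) jk by (auto simp: inj_on_def)
qed

end

section \<open>Tree automorphisms that fix the first level\<close>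

interpretation tree: group tree_aut
  by (rule group_tree_aut)

lemma mult_tree_aut [simp]: "f \<otimes>\<^bsub>tree_aut\<^esub> g = g \<circ> f"
  by (simp add: tree_aut_def)

lemma one_tree_aut [simp]: "\<one>\<^bsub>tree_aut\<^esub> = id"
  by (simp add: tree_aut_def)

lemma id_in_tree_aut: "id \<in> carrier tree_aut"
  using tree.one_closed by simp

text \<open>The automorphism \<open>(f,g,h)\<close> that fixes the first level.\<close>

fun sections :: "(word \<Rightarrow> word) \<Rightarrow> (word \<Rightarrow> word) \<Rightarrow> (word \<Rightarrow> word) \<Rightarrow> word \<Rightarrow> word" where
  "sections f g h [] = []"
| "sections f g h (X1 # w) = X1 # f w"
| "sections f g h (X2 # w) = X2 # g w"
| "sections f g h (X3 # w) = X3 # h w"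

lemma sections_eqI:
  assumes "k [] = []" "\<And>w. k (X1 # w) = X1 # f w" "\<And>w. k (X2 # w) = X2 # g w" "\<And>w. k (X3 # w) = X3 # h w"
  shows "k = sections f g h"
proof
  fix w show "k w = sections f g h w"
    using assms by (cases "(f, g, h, w)" rule: sections.cases) auto
qed

lemma sections_comp: "sections f' g' h' \<circ> sections f g h = sections (f' \<circ> f) (g' \<circ> g) (h' \<circ> h)"
  by (rule sections_eqI) auto

lemma sections_id: "sections id id id = id"
  by (rule sections_eqI[symmetric]) auto

lemma sections_eq_iff: "sections f g h = sections f' g' h' \<longleftrightarrow> f = f' \<and> g = g' \<and> h = h'"
proof
  assume eq: "sections f g h = sections f' g' h'"
  have "f w = f' w \<and> g w = g' w \<and> h w = h' w" for w
    using fun_cong[OF eq, of "X1 # w"] fun_cong[OF eq, of "X2 # w"] fun_cong[OF eq, of "X3 # w"] by simp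
  then show "f = f' \<and> g = g' \<and> h = h'" by auto
qed auto

lemma tree_adj_simps:
  "tree_adj [] v \<longleftrightarrow> (\<exists>x. v = [x])" "tree_adj u [] \<longleftrightarrow> (\<exists>x. u = [x])"
  "tree_adj (x # u) (y # v) \<longleftrightarrow> x = y \<and> tree_adj u v"
  by (auto simp: tree_adj_def)

lemma sections_in_tree_aut:
  assumes "f \<in> carrier tree_aut" "g \<in> carrier tree_aut" "h \<in> carrier tree_aut"
  shows "sections f g h \<in> carrier tree_aut"
proof -
  have *: "bij k" "k [] = []" "k w = [] \<longleftrightarrow> w = []" "tree_adj (k u) (k v) = tree_adj u v"
    if "k \<in> carrier tree_aut" for k u v w
    using that by (auto simp: tree_aut_def bij_def inj_eq) (metis injD)
  note f = *[OF assms(1)] and g = *[OF assms(2)] and h = *[OF assms(3)]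
  have "inv_into UNIV k \<circ> k = id" "k \<circ> inv_into UNIV k = id" if "bij k" for k :: "word \<Rightarrow> word"
    using that by (auto simp: bij_def surj_iff)
  then have "bij (sections f g h)"
    using f(1) g(1) h(1)
    by (intro o_bij[of "sections (inv_into UNIV f) (inv_into UNIV g) (inv_into UNIV h)"])
      (simp_all add: sections_comp sections_id)
  moreover have "tree_adj (sections f g h u) (sections f g h v) = tree_adj u v" for u v
    by (cases "(f, g, h, u)" rule: sections.cases; cases "(f, g, h, v)" rule: sections.cases)
      (simp_all add: tree_adj_simps f(2-) g(2-) h(2-))
  ultimately show ?thesis by (simp add: tree_aut_def)
qed

lemma inv_sections:
  assumes "f \<in> carrier tree_aut" "g \<in> carrier tree_aut" "h \<in> carrier tree_aut"
  shows "inv\<^bsub>tree_aut\<^esub> (sections f g h) = sections (inv\<^bsub>tree_aut\<^esub> f) (inv\<^bsub>tree_aut\<^esub> g) (inv\<^bsub>tree_aut\<^esub> h)"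
  using assms tree.l_inv
  by (intro tree.inv_equality) (simp_all add: sections_comp sections_id sections_in_tree_aut)

section \<open>Generators of the mother group\<close>

abbreviation swap13 :: "letter \<Rightarrow> letter" where "swap13 \<equiv> Transposition.transpose X1 X3"
abbreviation swap23 :: "letter \<Rightarrow> letter" where "swap23 \<equiv> Transposition.transpose X2 X3"

lemma transpose_permutes_UNIV: "Transposition.transpose (x :: letter) y permutes UNIV"
  by (simp add: permutes_swap_id)

lemma rooted_id: "rooted id = id"
proof
  fix w show "rooted id w = id w" by (cases w) auto
qed

lemma rooted_involution:
  assumes "\<And>x. a (a x) = x"
  shows "rooted a (rooted a w) = w"
  using assms by (cases w) auto

lemma directed_involution:
  assumes "\<And>x. a (a x) = x" "\<And>x. b (b x) = x" "\<And>x. s x = x"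
  shows "directed a b s (directed a b s w) = w"
proof (induction w)
  case (Cons x w)
  then show ?case using assms by (cases x) (simp_all add: rooted_involution)
qed simp

lemma directed_sections:
  "directed b1 b2 id = sections (rooted b1) (rooted b2) (directed b1 b2 id)"
  by (rule sections_eqI) auto

lemma swap13_conj: "rooted swap13 \<circ> sections f g h \<circ> rooted swap13 = sections h g f"
  by (rule sections_eqI) auto

lemma swap23_conj: "rooted swap23 \<circ> sections f g h \<circ> rooted swap23 = sections f h g"
  by (rule sections_eqI) auto

abbreviation "MG \<equiv> carrier mother_group"

lemma mother_subgroup: "subgroup MG tree_aut"
  by (simp add: mother_group_def tree.subgroup_subgroup_generated)

lemma mother_in_tree_aut: "f \<in> MG \<Longrightarrow> f \<in> carrier tree_aut"
  using mother_subgroup by (rule subgroup.mem_carrier)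

lemma mother_mult: "f \<in> MG \<Longrightarrow> g \<in> MG \<Longrightarrow> g \<circ> f \<in> MG"
  using subgroup.m_closed[OF mother_subgroup] by force

lemma mother_inv: "f \<in> MG \<Longrightarrow> inv\<^bsub>tree_aut\<^esub> f \<in> MG"
  using mother_subgroup by (rule subgroup.m_inv_closed)

lemma generators_in_mother: "S3_image \<union> B3_image \<subseteq> MG"
  unfolding mother_group_def
  using S3_image_subset B3_image_subset by (intro tree.subgroup_generated_subset_carrier_subset) auto

lemma rooted_in_mother: "a permutes UNIV \<Longrightarrow> rooted a \<in> MG"
  using generators_in_mother by (auto simp: S3_image_def)

lemma directed_in_mother: "b1 permutes UNIV \<Longrightarrow> b2 permutes UNIV \<Longrightarrow> directed b1 b2 id \<in> MG"
proof -
  assume "b1 permutes UNIV" "b2 permutes UNIV"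
  then have "directed b1 b2 id \<in> B3_image"
    unfolding B3_image_def using permutes_id by blast
  then show ?thesis using generators_in_mother by blast
qed

section \<open>Copies of elements of the mother group further down the tree\<close>

text \<open>Products of generators that are closed under lifting \<open>h\<close> to \<open>(1,y,h)\<close>: the second
generators \<open>d\<^sub>a = (1,a,d\<^sub>a)\<close> are lifts of themselves, and lifting \<open>a\<close> gives \<open>(1,d\<^sub>a,a)\<close>, a conjugate of
\<open>d\<^sub>a\<close>. That the section at \<open>1\<close> is trivial is what the commutator trick needs.\<close>

inductive_set liftable :: "(word \<Rightarrow> word) set" where
  rooted: "a permutes UNIV \<Longrightarrow> rooted a \<in> liftable"
| directed: "a permutes UNIV \<Longrightarrow> directed id a id \<in> liftable"
| comp: "f \<in> liftable \<Longrightarrow> g \<in> liftable \<Longrightarrow> g \<circ> f \<in> liftable"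

lemma liftable_in_mother: "h \<in> liftable \<Longrightarrow> h \<in> MG"
proof (induction rule: liftable.induct)
  case (comp f g)
  show ?case by (rule mother_mult[OF comp.IH])
qed (auto intro: rooted_in_mother directed_in_mother permutes_id)

lemma liftable_lift:
  "h \<in> liftable \<Longrightarrow> \<exists>y\<in>carrier tree_aut. sections id y h \<in> liftable"
proof (induction rule: liftable.induct)
  case (rooted a)
  have "rooted swap23 \<circ> directed id a id \<circ> rooted swap23 \<in> liftable"
    by (intro liftable.intros rooted transpose_permutes_UNIV)
  also have "rooted swap23 \<circ> directed id a id \<circ> rooted swap23
      = sections id (directed id a id) (rooted a)"
    by (subst directed_sections) (simp add: swap23_conj rooted_id)
  finally show ?case
    using mother_in_tree_aut directed_in_mother[OF permutes_id rooted] by blast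
next
  case (directed a)
  have "directed id a id = sections id (rooted a) (directed id a id)"
    using directed_sections[of id a] by (simp add: rooted_id)
  then show ?case
    using liftable.directed[OF directed] mother_in_tree_aut rooted_in_mother[OF directed] by metis
next
  case (comp f g)
  then obtain y z where "y \<in> carrier tree_aut" "z \<in> carrier tree_aut"
    "sections id y f \<in> liftable" "sections id z g \<in> liftable" by blast
  then show ?case
    using liftable.comp[of "sections id y f" "sections id z g"] tree.m_closed[of y z]
    unfolding sections_comp mult_tree_aut id_comp by blast
qed

abbreviation shift :: "(word \<Rightarrow> word) \<Rightarrow> word \<Rightarrow> word" where
  "shift h \<equiv> sections id id h"

text \<open>Elements whose copies at the root and below all vertices \<open>3\<dots>3\<close> belong to the mother group.\<close>

definition deep :: "(word \<Rightarrow> word) set" where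
  "deep = {h. \<forall>k. (shift ^^ k) h \<in> MG}"

lemma deepD: "h \<in> deep \<Longrightarrow> (shift ^^ k) h \<in> MG"
  by (simp add: deep_def)

lemma deep_in_mother: "h \<in> deep \<Longrightarrow> h \<in> MG"
  using deepD[of h 0] by simp

lemma deep_shift: "h \<in> deep \<Longrightarrow> shift h \<in> deep"
  using deepD[of h "Suc _"] by (simp add: deep_def funpow_swap1)

lemma shift_pow_Suc: "(shift ^^ Suc k) h = shift ((shift ^^ k) h)"
  by simp

lemma shift_pow_Suc2: "(shift ^^ Suc k) h = (shift ^^ k) (shift h)"
  by (simp add: funpow_swap1)

lemma shift_pow_comp: "(shift ^^ k) (g \<circ> f) = (shift ^^ k) g \<circ> (shift ^^ k) f"
proof (induction k)
  case (Suc k)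
  show ?case by (simp only: shift_pow_Suc Suc.IH sections_comp id_comp)
qed (simp only: funpow_0)

lemma shift_pow_in_tree_aut: "f \<in> carrier tree_aut \<Longrightarrow> (shift ^^ k) f \<in> carrier tree_aut"
  by (induction k) (simp_all add: sections_in_tree_aut id_in_tree_aut)

lemma inv_id: "inv\<^bsub>tree_aut\<^esub> id = id"
  using tree.inv_one by simp

lemma shift_pow_inv:
  "f \<in> carrier tree_aut \<Longrightarrow> (shift ^^ k) (inv\<^bsub>tree_aut\<^esub> f) = inv\<^bsub>tree_aut\<^esub> ((shift ^^ k) f)"
  by (induction k) (simp_all add: inv_sections id_in_tree_aut shift_pow_in_tree_aut inv_id)

lemma shift_pow_id: "(shift ^^ k) id = id"
proof (induction k)
  case (Suc k)
  show ?case by (simp only: shift_pow_Suc Suc.IH sections_id)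
qed (simp only: funpow_0)

lemma deep_subgroup: "subgroup deep tree_aut"
proof (rule tree.subgroupI)
  show "deep \<subseteq> carrier tree_aut" using deep_in_mother mother_in_tree_aut by blast
  have "id \<in> deep"
    using subgroup.one_closed[OF mother_subgroup] by (simp add: deep_def shift_pow_id)
  then show "deep \<noteq> {}" by blast
next
  show "inv\<^bsub>tree_aut\<^esub> a \<in> deep" if "a \<in> deep" for a
    using that mother_in_tree_aut[OF deep_in_mother[OF that]]
    by (simp add: deep_def shift_pow_inv mother_inv)
  show "a \<otimes>\<^bsub>tree_aut\<^esub> b \<in> deep" if "a \<in> deep" "b \<in> deep" for a b
    using that by (simp add: deep_def shift_pow_comp mother_mult)
qed

text \<open>Conjugating the copy of \<open>p\<close> below \<open>3\<close> by a lift of \<open>h\<close> gives the copy of the conjugate; lifts being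
liftable, this can be repeated at every depth.\<close>

lemma deep_conj:
  assumes "p \<in> deep" "h \<in> liftable"
  shows "h \<circ> p \<circ> inv\<^bsub>tree_aut\<^esub> h \<in> deep"
proof -
  have "(shift ^^ k) (h \<circ> p \<circ> inv\<^bsub>tree_aut\<^esub> h) \<in> MG" for k
    using assms
  proof (induction k arbitrary: p h)
    case 0
    then show ?case
      unfolding funpow_0 by (intro mother_mult mother_inv deep_in_mother liftable_in_mother)
  next
    case (Suc k)
    obtain y where y: "y \<in> carrier tree_aut" and lift: "sections id y h \<in> liftable"
      using liftable_lift[OF Suc.prems(2)] by blast
    have h: "h \<in> carrier tree_aut"
      using Suc.prems liftable_in_mother mother_in_tree_aut by blast
    have "y \<circ> inv\<^bsub>tree_aut\<^esub> y = id" using tree.l_inv[OF y] by simp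
    then have "sections id y h \<circ> shift p \<circ> inv\<^bsub>tree_aut\<^esub> (sections id y h)
        = shift (h \<circ> p \<circ> inv\<^bsub>tree_aut\<^esub> h)"
      using y h by (simp add: inv_sections sections_comp id_in_tree_aut inv_id)
    then show ?case
      using Suc.IH[OF deep_shift[OF Suc.prems(1)] lift] by (simp only: shift_pow_Suc2)
  qed
  then show ?thesis by (simp add: deep_def)
qed

text \<open>The sections \<open>(c,1,b)\<close> of \<open>b\<close> and \<open>(1,y,h)\<close> of a lift of \<open>h\<close> have nontrivial entries in common only
at \<open>3\<close>. Their commutator, which is in the group, is therefore the copy below \<open>3\<close> of the commutator
of \<open>b\<close> and \<open>h\<close>. Replacing \<open>h\<close> by its lift reaches the next depth.\<close>

lemma deep_commutator:
  assumes "c permutes UNIV" and "h \<in> liftable"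
  defines "b \<equiv> directed c id id"
  shows "h \<circ> b \<circ> inv\<^bsub>tree_aut\<^esub> h \<circ> inv\<^bsub>tree_aut\<^esub> b \<in> deep"
proof -
  have bM: "b \<in> MG" using assms directed_in_mother permutes_id by blast
  then have b: "b \<in> carrier tree_aut" by (rule mother_in_tree_aut)
  have c: "rooted c \<in> carrier tree_aut" using assms rooted_in_mother mother_in_tree_aut by blast
  have bs: "b = sections (rooted c) id b"
    unfolding b_def using directed_sections[of c id] by (simp add: rooted_id)
  have "(shift ^^ k) (h \<circ> b \<circ> inv\<^bsub>tree_aut\<^esub> h \<circ> inv\<^bsub>tree_aut\<^esub> b) \<in> MG" for k
    using assms(2)
  proof (induction k arbitrary: h)
    case 0
    then show ?case
      unfolding funpow_0 by (intro mother_mult mother_inv bM liftable_in_mother)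
  next
    case (Suc k)
    obtain y where y: "y \<in> carrier tree_aut" and lift: "sections id y h \<in> liftable"
      using liftable_lift[OF Suc.prems] by blast
    have h: "h \<in> carrier tree_aut"
      using Suc.prems liftable_in_mother mother_in_tree_aut by blast
    have id: "y \<circ> inv\<^bsub>tree_aut\<^esub> y = id" "rooted c \<circ> inv\<^bsub>tree_aut\<^esub> (rooted c) = id"
      using tree.l_inv[OF y] tree.l_inv[OF c] by simp_all
    have "sections id y h \<circ> b \<circ> inv\<^bsub>tree_aut\<^esub> (sections id y h) \<circ> inv\<^bsub>tree_aut\<^esub> b
        = sections id y h \<circ> sections (rooted c) id b \<circ> inv\<^bsub>tree_aut\<^esub> (sections id y h)
            \<circ> inv\<^bsub>tree_aut\<^esub> (sections (rooted c) id b)"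
      using bs by simp
    also have "\<dots> = shift (h \<circ> b \<circ> inv\<^bsub>tree_aut\<^esub> h \<circ> inv\<^bsub>tree_aut\<^esub> b)"
      using y h b c id by (simp add: inv_sections sections_comp id_in_tree_aut inv_id)
    finally show ?case
      using Suc.IH[OF lift] by (simp only: shift_pow_Suc2)
  qed
  then show ?thesis by (simp add: deep_def)
qed

section \<open>An element of infinite order\<close>

text \<open>The product of two involutions; they generate an infinite dihedral group.\<close>

definition rotation :: "word \<Rightarrow> word" where
  "rotation = rooted swap13 \<circ> directed swap13 id id"

definition rotation_sq :: "word \<Rightarrow> word" where
  "rotation_sq = rotation \<circ> rotation"

lemma rooted_swap13_invol: "rooted swap13 \<circ> rooted swap13 = id"
  by (simp add: fun_eq_iff rooted_involution)

lemma directed_swap13_invol: "directed swap13 id id \<circ> directed swap13 id id = id"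
  by (simp add: fun_eq_iff directed_involution)

lemma swap13_in_tree_aut:
  "rooted swap13 \<in> carrier tree_aut" "directed swap13 id id \<in> carrier tree_aut"
  using rooted_in_mother directed_in_mother mother_in_tree_aut transpose_permutes_UNIV permutes_id
  by blast+

lemma inv_swap13:
  "inv\<^bsub>tree_aut\<^esub> (rooted swap13) = rooted swap13"
  "inv\<^bsub>tree_aut\<^esub> (directed swap13 id id) = directed swap13 id id"
  using rooted_swap13_invol directed_swap13_invol swap13_in_tree_aut
  by (auto intro!: tree.inv_equality)

lemma rotation_in_tree_aut: "rotation \<in> carrier tree_aut"
  using tree.m_closed[OF swap13_in_tree_aut(2,1)] by (simp add: rotation_def)

lemma rotation_sq_in_tree_aut: "rotation_sq \<in> carrier tree_aut"
  using tree.m_closed[OF rotation_in_tree_aut rotation_in_tree_aut] by (simp add: rotation_sq_def)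

lemma rotation_sq_deep: "rotation_sq \<in> deep"
  using deep_commutator[OF transpose_permutes_UNIV liftable.rooted[OF transpose_permutes_UNIV],
      of X1 X3 X1 X3]
  by (simp add: inv_swap13 rotation_sq_def rotation_def comp_assoc)

lemma rotation_sq_sections: "rotation_sq = sections (inv\<^bsub>tree_aut\<^esub> rotation) id rotation"
proof -
  have "inv\<^bsub>tree_aut\<^esub> rotation = directed swap13 id id \<circ> rooted swap13"
    using tree.inv_mult_group[OF swap13_in_tree_aut(2,1)] by (simp add: rotation_def inv_swap13)
  moreover have "rooted swap13 (rooted swap13 w) = w" for w
    using fun_cong[OF rooted_swap13_invol, of w] by simp
  ultimately show ?thesis
    by (intro sections_eqI) (simp_all add: rotation_sq_def rotation_def rooted_id)
qed

lemma rotation_sq_pow_sections: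
  "\<exists>f g. (rotation_sq [^]\<^bsub>tree_aut\<^esub> (n::nat)) = sections f g (rotation [^]\<^bsub>tree_aut\<^esub> n)"
proof (induction n)
  case 0
  then show ?case using sections_id by (metis one_tree_aut tree.nat_pow_0)
next
  case (Suc n)
  then obtain f g where "rotation_sq [^]\<^bsub>tree_aut\<^esub> n = sections f g (rotation [^]\<^bsub>tree_aut\<^esub> n)" by blast
  then have "rotation_sq [^]\<^bsub>tree_aut\<^esub> Suc n
      = sections (inv\<^bsub>tree_aut\<^esub> rotation) id rotation \<circ> sections f g (rotation [^]\<^bsub>tree_aut\<^esub> n)"
    using rotation_sq_sections tree.nat_pow_Suc mult_tree_aut by metis
  also have "\<dots> = sections (inv\<^bsub>tree_aut\<^esub> rotation \<circ> f) (id \<circ> g) (rotation [^]\<^bsub>tree_aut\<^esub> Suc n)"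
    by (simp only: sections_comp tree.nat_pow_Suc mult_tree_aut)
  finally show ?case by blast
qed

lemma rotation_pow_even: "rotation [^]\<^bsub>tree_aut\<^esub> (2 * n :: nat) = rotation_sq [^]\<^bsub>tree_aut\<^esub> n"
proof -
  have "rotation [^]\<^bsub>tree_aut\<^esub> (2::nat) = rotation_sq"
    using rotation_in_tree_aut by (simp add: numeral_2_eq_2 rotation_sq_def)
  then show ?thesis
    using tree.nat_pow_pow[OF rotation_in_tree_aut, of 2 n] by simp
qed

text \<open>Infinite descent: a trivial power has even exponent \<open>2 m\<close>, as odd powers move the letter \<open>3\<close>, and
then the section at \<open>3\<close> of that power, the power with exponent \<open>m\<close>, is trivial too.\<close>

lemma rotation_infinite_order: "rotation [^]\<^bsub>tree_aut\<^esub> (n::nat) = id \<Longrightarrow> n = 0"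
proof (induction n rule: less_induct)
  case (less n)
  obtain m where "n = 2 * m \<or> n = Suc (2 * m)" by (metis oddE evenE Suc_eq_plus1)
  obtain f g where fg: "rotation_sq [^]\<^bsub>tree_aut\<^esub> m = sections f g (rotation [^]\<^bsub>tree_aut\<^esub> m)"
    using rotation_sq_pow_sections by blast
  have "n \<noteq> Suc (2 * m)"
  proof
    assume "n = Suc (2 * m)"
    then have "rotation [^]\<^bsub>tree_aut\<^esub> n = rotation \<circ> sections f g (rotation [^]\<^bsub>tree_aut\<^esub> m)"
      using fg rotation_pow_even[of m] by simp
    with less.prems have "id = rotation \<circ> sections f g (rotation [^]\<^bsub>tree_aut\<^esub> m)"
      by (simp only:)
    from fun_cong[OF this, of "[X3]"] show False by (simp add: rotation_def)
  qed
  with \<open>n = 2 * m \<or> n = Suc (2 * m)\<close> have n: "n = 2 * m" by blast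
  have "sections f g (rotation [^]\<^bsub>tree_aut\<^esub> m) = sections id id id"
    using less.prems unfolding n rotation_pow_even fg sections_id .
  then have "rotation [^]\<^bsub>tree_aut\<^esub> m = id"
    by (simp add: sections_eq_iff)
  then show ?case using less.IH[of m] n by (cases "m = 0") auto
qed

lemma rotation_sq_pow_inj: "rotation_sq [^]\<^bsub>tree_aut\<^esub> (i::int) = rotation_sq [^]\<^bsub>tree_aut\<^esub> (j::int) \<Longrightarrow> i = j"
proof -
  have nat: "n = 0" if "rotation_sq [^]\<^bsub>tree_aut\<^esub> (n::nat) = id" for n
    using that rotation_infinite_order[of "2 * n"] by (simp add: rotation_pow_even)
  assume eq: "rotation_sq [^]\<^bsub>tree_aut\<^esub> i = rotation_sq [^]\<^bsub>tree_aut\<^esub> j"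
  have "i = j" if "i \<le> j" "rotation_sq [^]\<^bsub>tree_aut\<^esub> i = rotation_sq [^]\<^bsub>tree_aut\<^esub> j" for i j :: int
  proof -
    have "rotation_sq [^]\<^bsub>tree_aut\<^esub> (j - i) = id"
      using that tree.r_inv[OF tree.int_pow_closed[OF rotation_sq_in_tree_aut, of j]]
      by (subst tree.int_pow_diff[OF rotation_sq_in_tree_aut]) simp
    then have "rotation_sq [^]\<^bsub>tree_aut\<^esub> (nat (j - i)) = id"
      using that by (metis int_nat_eq diff_ge_0_iff_ge int_pow_int)
    then show ?thesis using nat[of "nat (j - i)"] that by simp
  qed
  from this[of i j] this[of j i] eq show "i = j" by fastforce
qed

section \<open>A free abelian subgroup of infinite rank\<close>

text \<open>The infinite recursion \<open>(g\<^bsup>f 0\<^esup>, 1, (g\<^bsup>f 1\<^esup>, 1, \<dots>))\<close>, that is, \<open>g\<^bsup>f k\<^esup>\<close> acting below the vertex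
\<open>3\<^sup>k1\<close> for every \<open>k\<close>, where \<open>g\<close> is the square above.\<close>

fun spread :: "(nat \<Rightarrow> int) \<Rightarrow> word \<Rightarrow> word" where
  "spread f [] = []"
| "spread f (X1 # w) = X1 # (rotation_sq [^]\<^bsub>tree_aut\<^esub> f 0) w"
| "spread f (X2 # w) = X2 # w"
| "spread f (X3 # w) = X3 # spread (f \<circ> Suc) w"

lemma spread_sections: "spread f = sections (rotation_sq [^]\<^bsub>tree_aut\<^esub> f 0) id (spread (f \<circ> Suc))"
  by (rule sections_eqI) auto

lemma spread_zero: "spread (\<lambda>i. 0) = id"
proof
  fix w show "spread (\<lambda>i. 0) w = id w"
  proof (induction w)
    case (Cons x w)
    then show ?case by (cases x) (simp_all add: comp_def)
  qed simp
qed

lemma spread_add: "spread (\<lambda>i. f i + h i) = spread h \<circ> spread f"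
proof
  fix w show "spread (\<lambda>i. f i + h i) w = (spread h \<circ> spread f) w"
  proof (induction w arbitrary: f h)
    case (Cons x w)
    then show ?case
      using Cons[of "f \<circ> Suc" "h \<circ> Suc"] tree.int_pow_mult[OF rotation_sq_in_tree_aut, of "f 0" "h 0"]
      by (cases x) (simp_all add: comp_def)
  qed simp
qed

text \<open>The powers of an element of infinite order can be read off from the sections.\<close>

lemma spread_inj: "spread f = spread h \<Longrightarrow> f = h"
proof -
  have "f k = h k" if "spread f = spread h" for k
    using that
  proof (induction k arbitrary: f h)
    case 0
    then show ?case using spread_sections[of f] spread_sections[of h] rotation_sq_pow_inj
      by (metis sections_eq_iff)
  next
    case (Suc k)
    then have "spread (f \<circ> Suc) = spread (h \<circ> Suc)"
      using spread_sections[of f] spread_sections[of h] by (metis sections_eq_iff)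
    from Suc.IH[OF this] show ?case by simp
  qed
  then show "spread f = spread h \<Longrightarrow> f = h" by blast
qed

text \<open>By induction on the length of the support: \<open>(p,1,h)\<close> is the product of \<open>(p,1,1)\<close>, a conjugate of the
copy of \<open>p\<close> below \<open>3\<close>, and of the copy of \<open>h\<close> below \<open>3\<close>.\<close>

lemma spread_deep: "f \<in> finsupp \<Longrightarrow> spread f \<in> deep"
proof -
  have "spread f \<in> deep" if "\<forall>i\<ge>N. f i = 0" for N f
    using that
  proof (induction N arbitrary: f)
    case 0
    then have "f = (\<lambda>i. 0)" by auto
    with spread_zero have "spread f = id" by (simp only:)
    then show ?case
      using subgroup.one_closed[OF deep_subgroup] by (simp only: one_tree_aut)
  next
    case (Suc N)
    define p where "p = rotation_sq [^]\<^bsub>tree_aut\<^esub> f 0"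
    have "p \<in> deep"
      unfolding p_def by (rule tree.subgroup_int_pow_closed[OF deep_subgroup rotation_sq_deep])
    then have "rooted swap13 \<circ> shift p \<circ> inv\<^bsub>tree_aut\<^esub> (rooted swap13) \<in> deep"
      by (intro deep_conj deep_shift liftable.rooted transpose_permutes_UNIV)
    then have first: "sections p id id \<in> deep" by (simp add: inv_swap13 swap13_conj)
    have "spread (f \<circ> Suc) \<in> deep" using Suc by simp
    then have "shift (spread (f \<circ> Suc)) \<in> deep" by (rule deep_shift)
    from subgroup.m_closed[OF deep_subgroup first this]
    have "sections p id (spread (f \<circ> Suc)) \<in> deep" by (simp add: sections_comp)
    then show ?case using spread_sections[of f] by (simp add: p_def)
  qed
  then show "f \<in> finsupp \<Longrightarrow> spread f \<in> deep" by (auto simp: finsupp_def)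
qed

section \<open>The subgroup of the mother group\<close>

theorem theorem2:
  shows "\<exists>T. subgroup T mother_group \<and>
    (\<forall>l. proper_length_function (mother_group\<lparr>carrier := T\<rparr>) l \<longrightarrow>
      {length_metric (mother_group\<lparr>carrier := T\<rparr>) l} \<in> decomp_class (\<infinity>::enat) \<and>
      asdim_infinite (length_metric (mother_group\<lparr>carrier := T\<rparr>) l))"
proof (intro exI[of _ "spread ` finsupp"] conjI allI impI)
  have mother: "group mother_group"
    by (simp add: mother_group_def)
  have mult: "f \<otimes>\<^bsub>mother_group\<^esub> g = g \<circ> f" and one: "\<one>\<^bsub>mother_group\<^esub> = id" for f g
    by (simp_all add: mother_group_def)
  have spread_mother: "spread f \<in> MG" if "f \<in> finsupp" for f
    using spread_deep deep_in_mother that by blast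
  have inv: "inv\<^bsub>mother_group\<^esub> (spread f) = spread (\<lambda>i. - f i)" if f: "f \<in> finsupp" for f
    using spread_add[of "\<lambda>i. - f i" f] spread_zero f
    by (intro group.inv_equality[OF mother]) (simp_all add: mult one spread_mother finsupp_lin)
  show subgroup: "subgroup (spread ` finsupp) mother_group"
  proof (rule group.subgroupI[OF mother])
    show "spread ` finsupp \<subseteq> MG" using spread_mother by blast
    show "spread ` finsupp \<noteq> {}" using finsupp_zero by blast
    show "inv\<^bsub>mother_group\<^esub> a \<in> spread ` finsupp" if "a \<in> spread ` finsupp" for a
      using that inv finsupp_lin(3) by auto
    show "a \<otimes>\<^bsub>mother_group\<^esub> b \<in> spread ` finsupp" if "a \<in> spread ` finsupp" "b \<in> spread ` finsupp" for a b
      using that finsupp_lin(1) by (auto simp: mult spread_add[symmetric])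
  qed
  fix l assume "proper_length_function (mother_group\<lparr>carrier := spread ` finsupp\<rparr>) l"
  then interpret integer_coordinates "mother_group\<lparr>carrier := spread ` finsupp\<rparr>" spread l
    using group.subgroup_imp_group[OF mother subgroup] spread_inj
    by (auto simp: integer_coordinates_def integer_coordinates_axioms_def bij_betw_def inj_on_def
        mult spread_add)
  show "{M} \<in> decomp_class (\<infinity>::enat)" by (rule decomp_class_omega_M)
  show "asdim_infinite M" by (rule asdim_infinite_M)
qed

end
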